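(* Let $k$ be a field, $R=k[t_1,\dots,t_r]$ considered without grading, and let $(\tilde C,\tilde d)$ be an (ungraded) free differential $R$-module. Suppose that $\tilde C$ has a filtration $$0=\mathcal F_0(\tilde C)\subset\mathcal F_1(\tilde C)\subset\dots\subset\mathcal F_\ell(\tilde C)=\tilde C$$ by proper inclusions of free differential submodules which are direct summands as $R$-modules, such that (i) $\tilde d(\mathcal F_i(\tilde C))\subseteq\mathcal F_{i-1}(\tilde C)$ for $i=1,\dots,\ell$; (ii) (minimality) for $i=2,\dots,\ell$ the map $\mathcal F_i(\tilde C)/\mathcal F_{i-1}(\tilde C)\to\mathcal F_{i-1}(\tilde C)/\mathcal F_{i-2}(\tilde C)$ induced by $\tilde d$ is non-trivial; (iii) there is a morphism of differential $R$-modules $\varepsilon:\tilde C\to k$ whose restriction to $\mathcal F_1(\tilde C)$ is surjective. Suppose further that for some integers $m\ge 0$ and $1\le s\le r$ the annihilator ideal of $H(\tilde C)$ in $R$ contains $t_1^{m+1},\dots,t_s^{m+1}$. Then: (a) $\operatorname{rk}_R(\tilde C)\geq 2s$. (b) The length $\ell$ of the filtration of $\tilde C$ is at least $s+1$.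
   Context: A free differential $R$-module is a free $R$-module $\tilde C$ with an $R$-linear map $\tilde d:\tilde C\to\tilde C$, $\tilde d^2=0$; $H(\tilde C)=\ker\tilde d/\operatorname{im}\tilde d$. The field $k$ is an $R$-module via $t_i\mapsto 0$ and has trivial differential, so a morphism of differential modules $\varepsilon:\tilde C\to k$ is an $R$-linear map with $\varepsilon\tilde d=0$. *)

theory Defs
  imports
    Complex_Main
    "HOL-Library.Poly_Mapping"
    "HOL-Library.Set_Algebras"
    "HOL-Library.Extended_Nat"
begin

text \<open>
  Polynomials over \<open>'k\<close> in variables indexed by the finite type \<open>'v\<close>, as finitely
  supported families of coefficients indexed by monomials (exponent vectors).
\<close>

type_synonym ('v, 'k) mpoly = "('v \<Rightarrow>\<^sub>0 nat) \<Rightarrow>\<^sub>0 'k"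

definition mvar :: "'v \<Rightarrow> ('v, 'k::{zero,one}) mpoly"
  where "mvar v = Poly_Mapping.single (Poly_Mapping.single v 1) 1"

definition mconst :: "'k::zero \<Rightarrow> ('v, 'k) mpoly"
  where "mconst c = Poly_Mapping.single 0 c"

text \<open>
  The \<open>'k\<close>-algebra map sending every variable to 0 takes the constant term; it makes
  \<open>'k\<close> a module over the polynomial ring.
\<close>

definition eval0 :: "('v, 'k::zero) mpoly \<Rightarrow> 'k"
  where "eval0 p = Poly_Mapping.lookup p 0"

definition residue_scale :: "('v, 'k::comm_ring_1) mpoly \<Rightarrow> 'k \<Rightarrow> 'k"
  where "residue_scale p c = eval0 p * c"

lemma eval0_mvar: "eval0 (mvar v) = 0"
proof -
  have "Poly_Mapping.single v (1::nat) \<noteq> 0"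
    by (metis lookup_single_eq lookup_zero zero_neq_one)
  then show ?thesis
    by (simp add: eval0_def mvar_def lookup_single)
qed

lemma eval0_mconst: "eval0 (mconst c) = c"
  by (simp add: eval0_def mconst_def)

lemma eval0_one: "eval0 1 = 1"
  by (simp add: eval0_def)

lemma eval0_add: "eval0 (p + q) = eval0 p + eval0 q"
  by (simp add: eval0_def lookup_add)

lemma eval0_mult:
  fixes p q :: "('v, 'k::comm_ring_1) mpoly"
  shows "eval0 (p * q) = eval0 p * eval0 q"
proof -
  have z: "0 = l + m \<longleftrightarrow> l = 0 \<and> m = 0" for l m :: "'v \<Rightarrow>\<^sub>0 nat"
    by (auto simp: poly_mapping_eq_iff lookup_add fun_eq_iff)
  have inner: "(\<Sum>m. Poly_Mapping.lookup q m when 0 = l + m) = (eval0 q when l = 0)"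
    for l :: "'v \<Rightarrow>\<^sub>0 nat"
    by (cases "l = 0") (simp_all add: z eval0_def)
  show ?thesis
    unfolding eval0_def lookup_mult inner
    by (simp add: mult_when eval0_def)
qed

lemma module_residue_scale: "module residue_scale"
  by standard (simp_all add: residue_scale_def eval0_add eval0_mult eval0_one algebra_simps)


definition basis_of :: "('a::comm_ring_1 \<Rightarrow> 'c::ab_group_add \<Rightarrow> 'c) \<Rightarrow> 'c set \<Rightarrow> 'c set \<Rightarrow> bool"
  where "basis_of scale M B \<longleftrightarrow> \<not> module.dependent scale B \<and> module.span scale B = M"

definition free_submodule :: "('a::comm_ring_1 \<Rightarrow> 'c::ab_group_add \<Rightarrow> 'c) \<Rightarrow> 'c set \<Rightarrow> bool"
  where "free_submodule scale M \<longleftrightarrow> module.subspace scale M \<and> (\<exists>B. basis_of scale M B)"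

text \<open>
  All bases of a free module over a nonzero commutative ring have the same cardinality,
  so the choice of basis is immaterial; all infinite ranks are identified with \<open>\<infinity>\<close>.
\<close>

definition free_rank :: "('a::comm_ring_1 \<Rightarrow> 'c::ab_group_add \<Rightarrow> 'c) \<Rightarrow> 'c set \<Rightarrow> enat"
  where "free_rank scale M =
    (let B = (SOME B. basis_of scale M B) in if finite B then enat (card B) else \<infinity>)"

definition direct_summand :: "('a::comm_ring_1 \<Rightarrow> 'c::ab_group_add \<Rightarrow> 'c) \<Rightarrow> 'c set \<Rightarrow> bool"
  where "direct_summand scale M \<longleftrightarrow> module.subspace scale M \<and>
    (\<exists>N. module.subspace scale N \<and> M \<inter> N = {0} \<and> M + N = UNIV)"

locale differential_module = module_hom scale scale d
  for scale :: "'a::comm_ring_1 \<Rightarrow> 'c::ab_group_add \<Rightarrow> 'c" and d :: "'c \<Rightarrow> 'c" +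
  assumes d_squared: "d (d x) = 0"

definition differential_submodule ::
    "('a::comm_ring_1 \<Rightarrow> 'c::ab_group_add \<Rightarrow> 'c) \<Rightarrow> ('c \<Rightarrow> 'c) \<Rightarrow> 'c set \<Rightarrow> bool"
  where "differential_submodule scale d M \<longleftrightarrow> module.subspace scale M \<and> d ` M \<subseteq> M"

text \<open>
  Elements of a quotient \<open>M / N\<close> are the cosets \<open>x +o N\<close> with \<open>x \<in> M\<close>; its zero is \<open>N\<close>.
  For additive \<open>f\<close> mapping \<open>N\<close> into \<open>N'\<close>, all members of the union defining
  \<open>quotient_map f N' X\<close> coincide when \<open>X\<close> is a coset of \<open>N\<close>. With \<open>f = scale a\<close> and
  \<open>N' = N\<close> this is scalar multiplication on the quotient.
\<close>

definition quotient_module :: "'c::ab_group_add set \<Rightarrow> 'c set \<Rightarrow> 'c set set"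
  where "quotient_module M N = (\<lambda>x. x +o N) ` M"

definition quotient_map :: "('c \<Rightarrow> 'e::ab_group_add) \<Rightarrow> 'e set \<Rightarrow> 'c set \<Rightarrow> 'e set"
  where "quotient_map f N' X = (\<Union>x\<in>X. f x +o N')"

lemma quotient_map_coset:
  assumes "module_hom s1 s2 f" "module.subspace s1 N" "module.subspace s2 N'" "f ` N \<subseteq> N'"
  shows "quotient_map f N' (x +o N) = f x +o N'"
proof -
  interpret module_hom s1 s2 f by fact
  have zero: "0 \<in> N" "0 \<in> N'"
    using assms m1.subspace_0 m2.subspace_0 by auto
  have coset: "f (x + n) +o N' = f x +o N'" if "n \<in> N" for n
  proof -
    have fn: "f n \<in> N'" using that assms(4) by auto
    show ?thesis
    proof (intro equalityI subsetI)
      fix y assume "y \<in> f (x + n) +o N'"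
      then obtain b where "b \<in> N'" "y = f x + (f n + b)"
        by (auto simp: elt_set_plus_def add add.assoc)
      then show "y \<in> f x +o N'"
        using fn assms(3) m2.subspace_add by (auto simp: elt_set_plus_def)
    next
      fix y assume "y \<in> f x +o N'"
      then obtain b where "b \<in> N'" "y = f (x + n) + (b - f n)"
        by (auto simp: elt_set_plus_def add)
      then show "y \<in> f (x + n) +o N'"
        using fn assms(3) m2.subspace_diff by (auto simp: elt_set_plus_def)
    qed
  qed
  have "quotient_map f N' (x +o N) = (\<Union>n\<in>N. f (x + n) +o N')"
    by (auto simp: quotient_map_def elt_set_plus_def)
  also have "\<dots> = f x +o N'"
    using coset zero by auto
  finally show ?thesis .
qed

definition homology :: "('c::ab_group_add \<Rightarrow> 'c) \<Rightarrow> 'c set set"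
  where "homology d = quotient_module {x. d x = 0} (range d)"

definition homology_annihilator ::
    "('a::comm_ring_1 \<Rightarrow> 'c::ab_group_add \<Rightarrow> 'c) \<Rightarrow> ('c \<Rightarrow> 'c) \<Rightarrow> 'a set"
  where "homology_annihilator scale d =
    {a. \<forall>X\<in>homology d. quotient_map (scale a) (range d) X = range d}"

end

theory Submission
  imports Defs
begin

text \<open>
  Both bounds rest on explicit elements of the module \<open>C\<close>, filtered by \<open>F 0 \<subseteq> \<dots> \<subseteq> F l = C\<close>.

  \<^bold>\<open>Length.\<close> If \<open>l \<le> s\<close>, then the homology of \<open>C\<close> vanishes (an acyclicity lemma in the style of
  Peskine and Szpiro, \<open>acyclic_if_filtration_short\<close>). This is absurd: a cycle \<open>x\<close> in \<open>F 1\<close> with \<open>\<epsilon> x = 1\<close> is not a boundary,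
  because \<open>\<epsilon>\<close> kills boundaries. To see that a cycle \<open>x\<close> is a boundary, consider the Koszul cochains of
  \<open>a\<^sub>1, \<dots>, a\<^sub>s\<close> with values in \<open>C\<close>, where \<open>a\<^sub>i\<close> is a power of \<open>t\<^sub>i\<close>. Their total complex combines the Koszul
  differential with \<open>d\<close>, and \<open>x\<close> extends to a total cycle \<open>\<gamma>\<close> whose component in Koszul degree 0 is \<open>x\<close>: passing
  from one \<open>a\<^sub>i\<close> to the next, the obstruction is a homology class which a sufficiently high power of \<open>t\<^sub>i\<close>
  kills (\<open>extend_cycle_to_total\<close>). Repeat \<open>F l = C\<close> so that
  the filtration has \<open>s\<close> steps; then the top component of \<open>\<gamma>\<close> trivially lies in \<open>F s = C\<close>. If the components
  of degree \<open>j + 1\<close> lie in \<open>F (j + 1)\<close>, then \<open>d\<close> sends them to \<open>F j\<close>, so the components of degree \<open>j\<close> form a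
  Koszul cocycle modulo \<open>F j\<close>. The \<open>a\<^sub>i\<close> are a regular sequence on \<open>C / F j\<close>, so for \<open>j < s\<close> this cocycle is a
  coboundary, and subtracting a total boundary from \<open>\<gamma>\<close> moves its degree \<open>j\<close> components into \<open>F j\<close>
  (\<open>push_into_filtration\<close>). Each such change alters the component of degree 0 by a boundary of \<open>C\<close>
  only. After the last step this component lies in \<open>F 0 = {0}\<close>, whence \<open>x\<close> is a boundary.

  \<^bold>\<open>Rank.\<close> Minimality gives \<open>y\<^sub>i \<in> F i\<close> with \<open>d y\<^sub>i\<close> outside \<open>F (i - 2)\<close>, for \<open>2 \<le> i \<le> l\<close>. The quotients by the steps
  of the filtration are torsion-free, so the \<open>d y\<^sub>i\<close>, which lie in different steps, are linearly independent.
  Applying \<open>d\<close> to a linear relation between all the \<open>y\<^sub>i\<close> and \<open>d y\<^sub>i\<close> leaves a relation between the \<open>d y\<^sub>i\<close> alone, so these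
  \<open>2 * (l - 1)\<close> elements are independent, and \<open>l - 1 \<ge> s\<close> by the first part.
\<close>

section \<open>Koszul cochains with coefficients in a differential module\<close>

text \<open>
  A subset of the index set of a list \<open>as\<close> is encoded by the list of its membership bits, and a cochain
  by its values on these subsets. Read as iterated mapping cones of the multiplications by the
  elements of \<open>as\<close>, starting from a module with differential \<open>D\<close>, the cochains carry the total differential
  below; adding an element \<open>a\<close> turns a pair \<open>(x, y)\<close> into \<open>(D x, a x - D y)\<close>. The case \<open>D = 0\<close> is the Koszul
  differential itself. Only values on lists as long as \<open>as\<close> have a meaning.
\<close>

fun koszul :: "('a \<Rightarrow> 'c \<Rightarrow> 'c) \<Rightarrow> ('c \<Rightarrow> 'c) \<Rightarrow> 'a list \<Rightarrow> (bool list \<Rightarrow> 'c) \<Rightarrow> bool list \<Rightarrow> 'c::ab_group_add"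
  where
    "koszul scale D [] \<gamma> I = D (\<gamma> I)"
  | "koszul scale D (a # as) \<gamma> [] = 0"
  | "koszul scale D (a # as) \<gamma> (False # I) = koszul scale D as (\<lambda>J. \<gamma> (False # J)) I"
  | "koszul scale D (a # as) \<gamma> (True # I) =
      scale a (\<gamma> (False # I)) - koszul scale D as (\<lambda>J. \<gamma> (True # J)) I"

text \<open>Keeps \<open>scale\<close> and \<open>D\<close> fixed, unlike the induction rule of the recursion.\<close>

lemma koszul_induct [case_names Nil short False True]:
  fixes P :: "'a list \<Rightarrow> (bool list \<Rightarrow> 'c) \<Rightarrow> bool list \<Rightarrow> bool"
  assumes "\<And>\<gamma> I. P [] \<gamma> I"
    and "\<And>a as \<gamma>. P (a # as) \<gamma> []"
    and "\<And>a as \<gamma> I. P as (\<lambda>J. \<gamma> (False # J)) I \<Longrightarrow> P (a # as) \<gamma> (False # I)"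
    and "\<And>a as \<gamma> I. P as (\<lambda>J. \<gamma> (False # J)) I \<Longrightarrow> P as (\<lambda>J. \<gamma> (True # J)) I \<Longrightarrow> P (a # as) \<gamma> (True # I)"
  shows "P as \<gamma> I"
proof (induction as arbitrary: \<gamma> I)
  case IH: (Cons a as \<gamma> I)
  show ?case
  proof (cases I)
    case Nil
    then show ?thesis using assms(2) by simp
  next
    case (Cons b J)
    show ?thesis
    proof (cases b)
      case True
      then show ?thesis unfolding Cons using assms(4) IH.IH by simp
    next
      case False
      then show ?thesis unfolding Cons using assms(3) IH.IH by simp
    qed
  qed
qed (rule assms(1))

abbreviation deg :: "bool list \<Rightarrow> nat"
  where "deg I \<equiv> count_list I True"

lemma deg_le_length: "deg I \<le> length I"
  by (rule count_le_length)

lemma deg_eq_lengthD: "deg I = length I \<Longrightarrow> I = replicate (length I) True"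
proof (induction I)
  case (Cons b I)
  then show ?case using deg_le_length[of I] by (cases b) auto
qed simp

lemma deg_replicate: "deg (replicate n b) = (if b then n else 0)"
  by (induction n) auto

text \<open>
  A sufficient condition for the reversed list to be a weakly regular sequence modulo \<open>P\<close>: there is an
  operator \<open>Q\<close> that divides by \<open>a\<close> modulo \<open>P\<close> and commutes with the later elements \<open>b\<close> of the list. So if \<open>a x\<close>
  is a sum of multiples of the \<open>b\<close> modulo \<open>P\<close>, applying \<open>Q\<close> exhibits \<open>x\<close> as such a sum. Powers of distinct
  variables have such operators, which drop the monomials that are not divisible.
\<close>

fun division_regular :: "('a \<Rightarrow> 'b \<Rightarrow> 'b::ab_group_add) \<Rightarrow> 'b set \<Rightarrow> 'a list \<Rightarrow> bool"
  where "division_regular scale P [] \<longleftrightarrow> True"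
  | "division_regular scale P (a # as) \<longleftrightarrow> division_regular scale P as \<and>
      (\<exists>Q. additive Q \<and> Q ` P \<subseteq> P \<and> (\<forall>x. Q (scale a x) - x \<in> P) \<and>
           (\<forall>b\<in>set as. \<forall>x. Q (scale b x) = scale b (Q x)))"

context module
begin

lemma koszul_natural:
  assumes "additive h" "\<And>x. h (D x) = E (h x)" "\<And>b x. b \<in> set as \<Longrightarrow> h (scale b x) = scale b (h x)"
  shows "koszul scale E as (\<lambda>J. h (\<gamma> J)) I = h (koszul scale D as \<gamma> I)"
  using assms(3)
proof (induction as \<gamma> I rule: koszul_induct)
qed (auto simp: assms(2) additive.zero[OF assms(1)] additive.diff[OF assms(1)])

lemma koszul_diff:
  assumes "additive D"
  shows "koszul scale D as (\<lambda>J. \<gamma> J - \<zeta> J) I = koszul scale D as \<gamma> I - koszul scale D as \<zeta> I"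
proof (induction as \<gamma> I arbitrary: \<zeta> rule: koszul_induct)
qed (auto simp: additive.diff[OF assms] scale_right_diff_distrib)

lemma koszul_scale:
  assumes "module_hom scale scale D"
  shows "koszul scale D as (\<lambda>J. scale c (\<gamma> J)) I = scale c (koszul scale D as \<gamma> I)"
proof -
  interpret D: module_hom scale scale D by fact
  show ?thesis
    by (rule koszul_natural)
      (auto simp: D.scale scale_left_commute mult.commute scale_right_distrib intro: additive.intro)
qed

lemma koszul_uminus:
  assumes "additive D"
  shows "koszul scale D as (\<lambda>J. - \<gamma> J) I = - koszul scale D as \<gamma> I"
  by (rule koszul_natural) (auto simp: additive.minus[OF assms] intro: additive.intro)

lemma koszul_square:
  assumes D: "module_hom scale scale D" and "\<And>x. D (D x) = 0"
  shows "koszul scale D as (koszul scale D as \<gamma>) I = 0"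
proof -
  interpret D: module_hom scale scale D by fact
  show ?thesis
  proof (induction as \<gamma> I rule: koszul_induct)
    case (True a as \<gamma> I)
    have "koszul scale D as (\<lambda>J. koszul scale D (a # as) \<gamma> (True # J)) I =
      koszul scale D as (\<lambda>J. scale a (\<gamma> (False # J))) I -
      koszul scale D as (koszul scale D as (\<lambda>J. \<gamma> (True # J))) I"
      by (simp add: koszul_diff additive.intro D.add)
    with True show ?case
      by (simp add: koszul_scale[OF D])
  qed (auto simp: assms(2))
qed

lemma koszul_cong:
  assumes "\<And>J. length J = length as \<Longrightarrow> Suc (deg J) = deg I \<Longrightarrow> \<gamma> J = \<zeta> J"
    and "length I = length as"
  shows "koszul scale (\<lambda>_. 0) as \<gamma> I = koszul scale (\<lambda>_. 0) as \<zeta> I"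
  using assms
proof (induction as \<gamma> I arbitrary: \<zeta> rule: koszul_induct)
  case (False a as \<gamma> I)
  show ?case using False.prems by (auto intro!: False.IH)
next
  case (True a as \<gamma> I)
  have "koszul scale (\<lambda>_. 0) as (\<lambda>J. \<gamma> (True # J)) I = koszul scale (\<lambda>_. 0) as (\<lambda>J. \<zeta> (True # J)) I"
    using True.prems by (auto intro!: True.IH(2))
  then show ?case using True.prems by auto
qed auto

lemma koszul_total:
  assumes "length I = length as"
  shows "koszul scale D as \<gamma> I =
    koszul scale (\<lambda>_. 0) as \<gamma> I + (if even (deg I) then D (\<gamma> I) else - D (\<gamma> I))"
  using assms
proof (induction as \<gamma> I rule: koszul_induct)
qed auto

text \<open>
  The Koszul cohomology of a regular sequence vanishes below the top degree. Everything
  holds modulo \<open>P\<close>. For the list \<open>a # as\<close>, a cocycle is a pair \<open>(\<gamma>\<^sub>0, \<gamma>\<^sub>1)\<close> of cochains for \<open>as\<close>,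
  where \<open>\<gamma>\<^sub>0\<close> is a cocycle and \<open>a \<gamma>\<^sub>0\<close> is the coboundary of \<open>\<gamma>\<^sub>1\<close>. If \<open>\<gamma>\<^sub>0\<close>
  is the coboundary of \<open>\<alpha>\<close>, then \<open>a \<alpha> - \<gamma>\<^sub>1\<close> is a cocycle one degree lower, hence the coboundary of some \<open>\<beta>\<close>, and
  \<open>(\<alpha>, \<beta>)\<close> bounds the pair. Regularity of \<open>a\<close> enters only to obtain \<open>\<alpha>\<close> when \<open>\<gamma>\<^sub>0\<close> sits in the top degree of \<open>as\<close>.
\<close>

lemma koszul_exact:
  assumes "subspace P" "division_regular scale P as" "q < length as"
    and "\<And>I. length I = length as \<Longrightarrow> deg I = Suc q \<Longrightarrow> koszul scale (\<lambda>_. 0) as \<gamma> I \<in> P"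
  obtains \<zeta> where "\<And>J. length J = length as \<Longrightarrow> deg J = q \<Longrightarrow> \<gamma> J - koszul scale (\<lambda>_. 0) as \<zeta> J \<in> P"
  using assms(2-)
proof (induction as arbitrary: \<gamma> q thesis)
  case (Cons a as)
  let ?\<delta> = "koszul scale (\<lambda>_. 0)"
  let ?\<gamma>0 = "\<lambda>J. \<gamma> (False # J)" and ?\<gamma>1 = "\<lambda>J. \<gamma> (True # J)"
  have zero: "additive (\<lambda>_. 0 :: 'b)" by (simp add: additive_def)
  have zero_hom: "module_hom scale scale (\<lambda>_. 0)" by unfold_locales simp_all
  have exact: "thesis'" if "q' < length as"
    and "\<And>I. length I = length as \<Longrightarrow> deg I = Suc q' \<Longrightarrow> ?\<delta> as \<gamma>' I \<in> P"
    and "\<And>\<zeta>. (\<And>J. length J = length as \<Longrightarrow> deg J = q' \<Longrightarrow> \<gamma>' J - ?\<delta> as \<zeta> J \<in> P) \<Longrightarrow> thesis'"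
    for q' \<gamma>' thesis'
    by (rule Cons.IH[OF that(3) _ that(1,2)]) (use Cons.prems(2) in simp_all)
  have cocycle0: "?\<delta> as ?\<gamma>0 I \<in> P" if "length I = length as" "deg I = Suc q" for I
    using Cons.prems(4)[of "False # I"] that by simp
  have cocycle1: "scale a (\<gamma> (False # I)) - ?\<delta> as ?\<gamma>1 I \<in> P" if "length I = length as" "deg I = q" for I
    using Cons.prems(4)[of "True # I"] that by simp
  obtain \<alpha> where \<alpha>: "\<And>J. length J = length as \<Longrightarrow> deg J = q \<Longrightarrow> ?\<gamma>0 J - ?\<delta> as \<alpha> J \<in> P"
  proof (cases "q < length as")
    case True
    then show thesis using exact[OF True cocycle0] that by blast
  next
    case False
    then have q: "q = length as" using Cons.prems(3) by simp
    let ?T = "replicate (length as) True"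
    obtain Q where Q: "additive Q" "Q ` P \<subseteq> P" "\<And>x. Q (scale a x) - x \<in> P"
      "\<And>b x. b \<in> set as \<Longrightarrow> Q (scale b x) = scale b (Q x)"
      using Cons.prems(2) by auto
    have "scale a (\<gamma> (False # ?T)) - ?\<delta> as ?\<gamma>1 ?T \<in> P"
      by (rule cocycle1) (simp_all add: q deg_replicate)
    then have "Q (scale a (\<gamma> (False # ?T)) - ?\<delta> as ?\<gamma>1 ?T) \<in> P"
      using Q(2) by blast
    moreover have "?\<delta> as (\<lambda>J. Q (\<gamma> (True # J))) ?T = Q (?\<delta> as ?\<gamma>1 ?T)"
      by (rule koszul_natural) (auto simp: Q additive.zero)
    ultimately have "Q (scale a (\<gamma> (False # ?T))) - ?\<delta> as (\<lambda>J. Q (\<gamma> (True # J))) ?T \<in> P"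
      by (simp add: additive.diff[OF Q(1)])
    from subspace_diff[OF assms(1) this Q(3)[of "\<gamma> (False # ?T)"]]
    have "\<gamma> (False # ?T) - ?\<delta> as (\<lambda>J. Q (\<gamma> (True # J))) ?T \<in> P"
      by (simp add: algebra_simps)
    then show thesis
      using that[of "\<lambda>J. Q (\<gamma> (True # J))"] deg_eq_lengthD q by metis
  qed
  obtain \<beta> where \<beta>: "\<And>J. length J = length as \<Longrightarrow> Suc (deg J) = q \<Longrightarrow>
    scale a (\<alpha> J) - \<gamma> (True # J) - ?\<delta> as \<beta> J \<in> P"
  proof (cases q)
    case (Suc p)
    have "?\<delta> as (\<lambda>J. scale a (\<alpha> J) - \<gamma> (True # J)) I \<in> P"
      if "length I = length as" "deg I = Suc p" for I
    proof -
      have "scale a (\<gamma> (False # I) - ?\<delta> as \<alpha> I) \<in> P"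
        using \<alpha> that Suc by (simp add: assms(1) subspace_scale)
      from subspace_diff[OF assms(1) cocycle1[OF that(1)] this] that(2) Suc
      have "scale a (?\<delta> as \<alpha> I) - ?\<delta> as ?\<gamma>1 I \<in> P"
        by (simp add: scale_right_diff_distrib)
      then show ?thesis
        by (simp add: koszul_diff[OF zero] koszul_scale[OF zero_hom])
    qed
    then show thesis
      using exact[of p "\<lambda>J. scale a (\<alpha> J) - \<gamma> (True # J)"] that Cons.prems(3) Suc by auto
  qed (use that in simp)
  define \<zeta> where "\<zeta> I = (case I of [] \<Rightarrow> 0 | b # J \<Rightarrow> if b then \<beta> J else \<alpha> J)" for I
  show thesis
  proof (rule Cons.prems(1))
    fix J assume J: "length J = length (a # as)" "deg J = q"
    then obtain b J' where J': "J = b # J'" by (cases J) auto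
    show "\<gamma> J - ?\<delta> (a # as) \<zeta> J \<in> P"
    proof (cases b)
      case True
      then show ?thesis
        using subspace_neg[OF assms(1) \<beta>[of J']] J J' by (simp add: \<zeta>_def algebra_simps)
    next
      case False
      then show ?thesis using \<alpha>[of J'] J J' by (simp add: \<zeta>_def)
    qed
  qed
qed simp

end

section \<open>Acyclicity\<close>

context differential_module
begin

lemma additive_d: "additive d"
  by (simp add: additive_def add)

lemma module_hom_d: "module_hom scale scale d"
  by (rule module_hom_axioms)

abbreviation "total_d \<equiv> koszul scale d"

lemmas total_simps = m1.koszul_diff[OF additive_d] m1.koszul_scale[OF module_hom_d]
  m1.koszul_uminus[OF additive_d]

text \<open>
  The homology of a mapping cone is an extension of two pieces of the old homology, so each cone
  squares the power of \<open>g\<close> that is needed.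
\<close>

lemma total_homology_annihilated:
  assumes g: "\<And>z. d z = 0 \<Longrightarrow> \<exists>w. scale g z = d w"
    and "\<And>I. length I = length as \<Longrightarrow> total_d as \<gamma> I = 0"
  shows "\<exists>\<upsilon>. \<forall>I. length I = length as \<longrightarrow> scale (g ^ 2 ^ length as) (\<gamma> I) = total_d as \<upsilon> I"
  using assms(2)
proof (induction as arbitrary: \<gamma>)
  case Nil
  then obtain w where "scale g (\<gamma> []) = d w" using g[of "\<gamma> []"] by auto
  then show ?case by (intro exI[of _ "\<lambda>_. w"]) simp
next
  case (Cons a as)
  let ?h = "g ^ 2 ^ length as"
  have cycle0: "total_d as (\<lambda>J. \<gamma> (False # J)) I = 0" if "length I = length as" for I
    using Cons.prems[of "False # I"] that by simp
  have cycle1: "total_d as (\<lambda>J. \<gamma> (True # J)) I = scale a (\<gamma> (False # I))" if "length I = length as" for I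
    using Cons.prems[of "True # I"] that by simp
  from Cons.IH[OF cycle0] obtain \<alpha> where
    \<alpha>: "\<And>I. length I = length as \<Longrightarrow> scale ?h (\<gamma> (False # I)) = total_d as \<alpha> I"
    by auto
  \<comment> \<open>Subtracting the boundary of \<open>\<alpha>\<close> from \<open>?h\<close> times the cycle leaves a cycle in the second summand.\<close>
  have "total_d as (\<lambda>J. scale ?h (\<gamma> (True # J)) - scale a (\<alpha> J)) I = 0" if "length I = length as" for I
    by (simp only: total_simps cycle1[OF that] \<alpha>[OF that, symmetric] m1.scale_left_commute[of a]) simp
  from Cons.IH[OF this] obtain \<beta> where
    \<beta>: "\<And>I. length I = length as \<Longrightarrow>
      scale ?h (scale ?h (\<gamma> (True # I)) - scale a (\<alpha> I)) = total_d as \<beta> I"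
    by auto
  define \<upsilon> where "\<upsilon> I = (case I of [] \<Rightarrow> 0 | b # J \<Rightarrow> if b then - \<beta> J else scale ?h (\<alpha> J))" for I
  have hh: "g ^ 2 ^ length (a # as) = ?h * ?h"
    by (simp add: power_add[symmetric] mult_2)
  have "scale (?h * ?h) (\<gamma> I) = total_d (a # as) \<upsilon> I" if len: "length I = length (a # as)" for I
  proof -
    obtain b J where I: "I = b # J" "length J = length as" using len by (cases I) auto
    show ?thesis
    proof (cases b)
      case True
      then show ?thesis
        using \<beta>[OF I(2)] I
        by (simp add: \<upsilon>_def total_simps m1.scale_right_diff_distrib m1.scale_left_commute[of a] mult.commute
            algebra_simps)
    next
      case False
      then show ?thesis
        using \<alpha>[OF I(2)] I by (simp add: \<upsilon>_def total_simps flip: m1.scale_scale)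
    qed
  qed
  then show ?case unfolding hh by blast
qed

text \<open>
  A total cycle \<open>\<alpha>\<close> for the list \<open>as\<close> extends to \<open>a # as\<close> as soon as \<open>a\<close> kills its homology class: a cochain
  with boundary \<open>a \<alpha>\<close> supplies the values on the sets that contain the new index. The exponent \<open>2 ^ n\<close>
  is large enough for all lists involved.
\<close>

lemma extend_cycle_to_total:
  assumes "\<And>g z. g \<in> set gs \<Longrightarrow> d z = 0 \<Longrightarrow> \<exists>w. scale g z = d w"
    and "d x = 0" and "length gs \<le> n"
  shows "\<exists>\<gamma>. (\<forall>I. length I = length gs \<longrightarrow> total_d (map (\<lambda>g. g ^ 2 ^ n) gs) \<gamma> I = 0) \<and>
    \<gamma> (replicate (length gs) False) = x"
  using assms(1,3)
proof (induction gs)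
  case Nil
  then show ?case using assms(2) by (intro exI[of _ "\<lambda>_. x"]) simp
next
  case (Cons g gs)
  let ?as = "map (\<lambda>g. g ^ 2 ^ n) gs"
  obtain \<alpha> where \<alpha>: "\<And>I. length I = length gs \<Longrightarrow> total_d ?as \<alpha> I = 0"
    "\<alpha> (replicate (length gs) False) = x"
    using Cons.IH Cons.prems by auto
  have "\<exists>\<upsilon>. \<forall>I. length I = length ?as \<longrightarrow> scale (g ^ 2 ^ length ?as) (\<alpha> I) = total_d ?as \<upsilon> I"
    using Cons.prems(1)[of g] \<alpha>(1) by (intro total_homology_annihilated) auto
  then obtain \<upsilon> where \<upsilon>: "\<And>I. length I = length gs \<Longrightarrow> scale (g ^ 2 ^ length gs) (\<alpha> I) = total_d ?as \<upsilon> I"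
    by auto
  have split: "g ^ 2 ^ n = g ^ (2 ^ n - 2 ^ length gs) * g ^ 2 ^ length gs"
    using Cons.prems(2) by (simp flip: power_add)
  define \<beta> where "\<beta> I = scale (g ^ (2 ^ n - 2 ^ length gs)) (\<upsilon> I)" for I
  have \<beta>: "total_d ?as \<beta> I = scale (g ^ 2 ^ n) (\<alpha> I)" if "length I = length gs" for I
    unfolding \<beta>_def using \<upsilon>[OF that] by (simp add: total_simps split flip: m1.scale_scale)
  define \<gamma> where "\<gamma> I = (case I of [] \<Rightarrow> 0 | b # J \<Rightarrow> if b then \<beta> J else \<alpha> J)" for I
  have "total_d (map (\<lambda>g. g ^ 2 ^ n) (g # gs)) \<gamma> I = 0" if len: "length I = length (g # gs)" for I
  proof -
    obtain b J where I: "I = b # J" "length J = length gs" using len by (cases I) auto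
    then show ?thesis using \<alpha>(1) \<beta> by (cases b) (simp_all add: \<gamma>_def)
  qed
  moreover have "\<gamma> (replicate (length (g # gs)) False) = x"
    using \<alpha>(2) by (simp add: \<gamma>_def)
  ultimately show ?case by blast
qed

lemma total_replicate_False: "total_d as \<gamma> (replicate (length as) False) = d (\<gamma> (replicate (length as) False))"
  by (induction as arbitrary: \<gamma>) auto

text \<open>
  In a total cycle, the Koszul coboundary of the degree \<open>j\<close> values is \<open>d\<close> of the values in degree \<open>j + 1\<close>,
  up to sign. So the degree \<open>j\<close> values are a cocycle modulo \<open>P\<close>, and a primitive \<open>\<zeta>\<close> of it modulo \<open>P\<close> tells
  which total boundary to subtract.
\<close>

lemma push_into_filtration:
  assumes P: "m1.subspace P" "division_regular scale P as" and j: "j < length as"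
    and cycle: "\<And>I. length I = length as \<Longrightarrow> total_d as \<gamma> I = 0"
    and high: "\<And>I. length I = length as \<Longrightarrow> deg I = Suc j \<Longrightarrow> d (\<gamma> I) \<in> P"
  obtains \<gamma>' where "\<And>I. length I = length as \<Longrightarrow> total_d as \<gamma>' I = 0"
    "\<And>I. length I = length as \<Longrightarrow> deg I = j \<Longrightarrow> \<gamma>' I \<in> P"
    "\<gamma> (replicate (length as) False) - \<gamma>' (replicate (length as) False) \<in> range d"
proof -
  have "koszul scale (\<lambda>_. 0) as \<gamma> I \<in> P" if "length I = length as" "deg I = Suc j" for I
    using m1.koszul_total[OF that(1), of d \<gamma>] cycle[OF that(1)] high[OF that] m1.subspace_neg[OF P(1) high[OF that]]
    by (auto simp: add_eq_0_iff2 split: if_splits)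
  from m1.koszul_exact[OF P j this] obtain \<zeta> where
    \<zeta>: "\<And>J. length J = length as \<Longrightarrow> deg J = j \<Longrightarrow> \<gamma> J - koszul scale (\<lambda>_. 0) as \<zeta> J \<in> P"
    by blast
  \<comment> \<open>Cutting \<open>\<zeta>\<close> down to degree \<open>j - 1\<close> keeps \<open>d (\<eta> I)\<close> out of the degree \<open>j\<close> part of \<open>total_d as \<eta>\<close>.\<close>
  define \<eta> where "\<eta> J = (if Suc (deg J) = j then \<zeta> J else 0)" for J
  define \<gamma>' where "\<gamma>' = (\<lambda>J. \<gamma> J - total_d as \<eta> J)"
  show thesis
  proof
    show "total_d as \<gamma>' I = 0" if "length I = length as" for I
      using cycle[OF that]
      by (simp add: \<gamma>'_def total_simps m1.koszul_square[OF module_hom_d d_squared])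
    show "\<gamma>' I \<in> P" if "length I = length as" "deg I = j" for I
    proof -
      have "total_d as \<eta> I = koszul scale (\<lambda>_. 0) as \<eta> I"
        using m1.koszul_total[OF that(1), of d \<eta>] that(2) by (simp add: \<eta>_def)
      also have "\<dots> = koszul scale (\<lambda>_. 0) as \<zeta> I"
        by (rule m1.koszul_cong) (use that in \<open>auto simp: \<eta>_def\<close>)
      finally show ?thesis using \<zeta>[OF that] by (simp add: \<gamma>'_def)
    qed
    show "\<gamma> (replicate (length as) False) - \<gamma>' (replicate (length as) False) \<in> range d"
      by (simp add: \<gamma>'_def total_replicate_False)
  qed
qed

text \<open>
  Acyclicity lemma: nonzero homology killed by \<open>s\<close> elements, whose powers form regular sequences modulo the
  steps of the filtration, requires more than \<open>s\<close> steps.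
\<close>

theorem acyclic_if_filtration_short:
  assumes G: "\<And>i. i \<le> length gs \<Longrightarrow> m1.subspace (G i)" "G 0 = {0}" "G (length gs) = UNIV"
    "\<And>i. i < length gs \<Longrightarrow> d ` G (Suc i) \<subseteq> G i"
    and regular: "\<And>i N. i < length gs \<Longrightarrow> division_regular scale (G i) (map (\<lambda>g. g ^ N) gs)"
    and ann: "\<And>g z. g \<in> set gs \<Longrightarrow> d z = 0 \<Longrightarrow> \<exists>w. scale g z = d w"
    and "d x = 0"
  shows "x \<in> range d"
proof -
  define as where "as = map (\<lambda>g. g ^ 2 ^ length gs) gs"
  let ?o = "replicate (length gs) False"
  have len: "length as = length gs" by (simp add: as_def)
  \<comment> \<open>Descend from \<open>j = length gs\<close>, where the filtration imposes nothing, to \<open>j = 0\<close>.\<close>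
  have "\<exists>\<gamma>. (\<forall>I. length I = length gs \<longrightarrow> total_d as \<gamma> I = 0) \<and>
    (\<forall>I. length I = length gs \<longrightarrow> deg I = j \<longrightarrow> \<gamma> I \<in> G j) \<and> x - \<gamma> ?o \<in> range d"
    if "j \<le> length gs" for j
    using that
  proof (induction rule: inc_induct)
    case base
    obtain \<gamma> where "\<forall>I. length I = length gs \<longrightarrow> total_d as \<gamma> I = 0" "\<gamma> ?o = x"
      using extend_cycle_to_total[OF ann \<open>d x = 0\<close>] unfolding as_def by blast
    then show ?case using G(3) by (intro exI[of _ \<gamma>]) (auto intro: range_eqI[of _ _ 0])
  next
    case (step j)
    then obtain \<gamma> where \<gamma>: "\<And>I. length I = length as \<Longrightarrow> total_d as \<gamma> I = 0"
      "\<And>I. length I = length as \<Longrightarrow> deg I = Suc j \<Longrightarrow> \<gamma> I \<in> G (Suc j)" "x - \<gamma> ?o \<in> range d"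
      unfolding len by blast
    have "d (\<gamma> I) \<in> G j" if "length I = length as" "deg I = Suc j" for I
      using \<gamma>(2)[OF that] G(4)[of j] step by auto
    moreover have "division_regular scale (G j) as" unfolding as_def using regular step by simp
    moreover have "m1.subspace (G j)" "j < length as" using G(1) step by (simp_all add: len)
    ultimately obtain \<gamma>' where \<gamma>': "\<And>I. length I = length as \<Longrightarrow> total_d as \<gamma>' I = 0"
      "\<And>I. length I = length as \<Longrightarrow> deg I = j \<Longrightarrow> \<gamma>' I \<in> G j" "\<gamma> ?o - \<gamma>' ?o \<in> range d"
      using push_into_filtration[of "G j" as j \<gamma>] \<gamma>(1) unfolding len by metis
    from \<gamma>(3) \<gamma>'(3) obtain u v where "x - \<gamma> ?o = d u" "\<gamma> ?o - \<gamma>' ?o = d v" by blast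
    then have "x - \<gamma>' ?o = d (u + v)" by (simp add: add algebra_simps)
    with \<gamma>'(1,2) show ?case unfolding len by blast
  qed
  then obtain \<gamma> where \<gamma>: "\<forall>I. length I = length gs \<longrightarrow> deg I = 0 \<longrightarrow> \<gamma> I \<in> G 0" "x - \<gamma> ?o \<in> range d"
    by blast
  have "\<gamma> ?o \<in> G 0" using \<gamma>(1) by (simp add: deg_replicate)
  with G(2) \<gamma>(2) show ?thesis by simp
qed

end
section \<open>Division by powers of variables, and zero divisors\<close>

lemma mvar_power: "mvar v ^ n = Poly_Mapping.single (Poly_Mapping.single v n) (1 :: 'k::comm_ring_1)"
  by (induction n) (auto simp: mvar_def mult_single simp flip: single_add)

lemma additive_eq_on_monomials:
  fixes f g :: "('m \<Rightarrow>\<^sub>0 'k::comm_monoid_add) \<Rightarrow> 'b::ab_group_add"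
  assumes f: "\<And>x y. f (x + y) = f x + f y" and g: "\<And>x y. g (x + y) = g x + g y"
    and monomials: "\<And>m c. f (Poly_Mapping.single m c) = g (Poly_Mapping.single m c)"
  shows "f p = g p"
proof (induction p rule: update_induct)
  case const
  then show ?case using monomials[of _ 0] by simp
next
  case (update p m c)
  then have "Poly_Mapping.update m c p = p + Poly_Mapping.single m c"
    by (intro poly_mapping_eqI) (auto simp: lookup_update lookup_add lookup_single when_def in_keys_iff)
  then show ?case using update f g monomials by simp
qed

text \<open>
  Division with remainder by \<open>mvar v ^ N\<close>: the monomials that are not divisible are dropped.
\<close>

definition divide_mvar :: "'v \<Rightarrow> nat \<Rightarrow> ('v, 'k::comm_ring_1) mpoly \<Rightarrow> ('v, 'k) mpoly"
  where "divide_mvar v N = Poly_Mapping.map_key (\<lambda>m. m + Poly_Mapping.single v N)"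

lemma lookup_divide_mvar:
  "Poly_Mapping.lookup (divide_mvar v N p) m = Poly_Mapping.lookup p (m + Poly_Mapping.single v N)"
  unfolding divide_mvar_def by (subst map_key.rep_eq) (auto simp: inj_on_def)

lemma divide_mvar_add: "divide_mvar v N (p + q) = divide_mvar v N p + divide_mvar v N q"
  by (rule poly_mapping_eqI) (simp add: lookup_divide_mvar lookup_add)

lemma divide_mvar_single:
  "divide_mvar v N (Poly_Mapping.single m c) =
    (if N \<le> Poly_Mapping.lookup m v then Poly_Mapping.single (m - Poly_Mapping.single v N) c else 0)"
proof -
  have "m = m' + Poly_Mapping.single v N \<longleftrightarrow>
    N \<le> Poly_Mapping.lookup m v \<and> m - Poly_Mapping.single v N = m'" for m'
    by (force simp: poly_mapping_eq_iff fun_eq_iff lookup_add lookup_minus lookup_single when_def)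
  then show ?thesis
    by (intro poly_mapping_eqI) (auto simp: lookup_divide_mvar lookup_single when_def)
qed

lemma divide_mvar_self: "divide_mvar v N (mvar v ^ N * p) = p"
proof (rule additive_eq_on_monomials[where f = "\<lambda>p. divide_mvar v N (mvar v ^ N * p)"])
qed (auto simp: divide_mvar_add distrib_left mvar_power mult_single divide_mvar_single lookup_add)

lemma divide_mvar_other:
  assumes "u \<noteq> v"
  shows "divide_mvar v N (mvar u ^ n * p) = mvar u ^ n * divide_mvar v N p"
proof (rule additive_eq_on_monomials[where f = "\<lambda>p. divide_mvar v N (mvar u ^ n * p)"])
  fix m :: "'a \<Rightarrow>\<^sub>0 nat" and c :: 'b
  have "Poly_Mapping.single u n + m - Poly_Mapping.single v N =
    Poly_Mapping.single u n + (m - Poly_Mapping.single v N)" (is ?eq)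
    using assms
    by (intro poly_mapping_eqI) (auto simp: lookup_add lookup_minus lookup_single when_def)
  then show "divide_mvar v N (mvar u ^ n * Poly_Mapping.single m c) =
    mvar u ^ n * divide_mvar v N (Poly_Mapping.single m c)"
    using assms by (simp add: mvar_power mult_single divide_mvar_single lookup_add lookup_single when_def)
qed (simp_all add: divide_mvar_add distrib_left)

text \<open>
  Maximizing the exponents one variable after the other, that is lexicographically, selects \<open>a\<close> and \<open>b\<close>:
  in a pair with the same sum, no exponent of the current variable exceeds the maximum, so both attain it.
\<close>

lemma extreme_monomials:
  fixes A B :: "('v \<Rightarrow>\<^sub>0 nat) set"
  assumes "finite V" "finite A" "A \<noteq> {}" "finite B" "B \<noteq> {}"
  obtains a b where "a \<in> A" "b \<in> B"
    "\<And>a' b' v. a' \<in> A \<Longrightarrow> b' \<in> B \<Longrightarrow> a' + b' = a + b \<Longrightarrow> v \<in> V \<Longrightarrow>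
      Poly_Mapping.lookup a' v = Poly_Mapping.lookup a v \<and> Poly_Mapping.lookup b' v = Poly_Mapping.lookup b v"
  using assms
proof (induction arbitrary: A B thesis rule: finite_induct)
  case empty
  then show ?case by blast
next
  case (insert v V)
  let ?top = "\<lambda>S. {m \<in> S. Poly_Mapping.lookup m v = Max ((\<lambda>m. Poly_Mapping.lookup m v) ` S)}"
  have top: "?top S \<noteq> {}" if "finite S" "S \<noteq> {}" for S
  proof -
    have "Max ((\<lambda>m. Poly_Mapping.lookup m v) ` S) \<in> (\<lambda>m. Poly_Mapping.lookup m v) ` S"
      using that by (intro Max_in) auto
    then obtain m where "Max ((\<lambda>m. Poly_Mapping.lookup m v) ` S) = Poly_Mapping.lookup m v" "m \<in> S"
      by (rule imageE)
    then have "m \<in> ?top S" by simp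
    then show ?thesis by blast
  qed
  obtain a b where ab: "a \<in> ?top A" "b \<in> ?top B"
    and unique: "\<And>a' b' u. a' \<in> ?top A \<Longrightarrow> b' \<in> ?top B \<Longrightarrow> a' + b' = a + b \<Longrightarrow> u \<in> V \<Longrightarrow>
      Poly_Mapping.lookup a' u = Poly_Mapping.lookup a u \<and> Poly_Mapping.lookup b' u = Poly_Mapping.lookup b u"
  proof (rule insert.IH)
    show "finite (?top A)" "finite (?top B)" using insert.prems by simp_all
    show "?top A \<noteq> {}" by (rule top[OF insert.prems(2,3)])
    show "?top B \<noteq> {}" by (rule top[OF insert.prems(4,5)])
  qed (rule that)
  show thesis
  proof (rule insert.prems(1))
    show "a \<in> A" "b \<in> B" using ab by auto
    fix a' b' u
    assume *: "a' \<in> A" "b' \<in> B" "a' + b' = a + b" "u \<in> insert v V"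
    have "Poly_Mapping.lookup a' v \<le> Poly_Mapping.lookup a v" "Poly_Mapping.lookup b' v \<le> Poly_Mapping.lookup b v"
      using ab * insert.prems by auto
    moreover have "Poly_Mapping.lookup a' v + Poly_Mapping.lookup b' v = Poly_Mapping.lookup a v + Poly_Mapping.lookup b v"
      using *(3) by (metis lookup_add)
    ultimately have v: "Poly_Mapping.lookup a' v = Poly_Mapping.lookup a v" "Poly_Mapping.lookup b' v = Poly_Mapping.lookup b v"
      by linarith+
    then have "a' \<in> ?top A" "b' \<in> ?top B" using ab * by auto
    with v *(3,4) unique show "Poly_Mapping.lookup a' u = Poly_Mapping.lookup a u \<and> Poly_Mapping.lookup b' u = Poly_Mapping.lookup b u"
      by blast
  qed
qed

text \<open>The product monomial of two lexicographically largest monomials arises in only one way, so its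
  coefficient is a product of two nonzero coefficients.\<close>

lemma mpoly_no_zero_divisors:
  fixes p q :: "('v::finite, 'k::field) mpoly"
  assumes "p * q = 0"
  shows "p = 0 \<or> q = 0"
proof (rule ccontr)
  assume "\<not> ?thesis"
  then have "Poly_Mapping.keys p \<noteq> {}" "Poly_Mapping.keys q \<noteq> {}" by simp_all
  then obtain a b where ab: "a \<in> Poly_Mapping.keys p" "b \<in> Poly_Mapping.keys q"
    and unique: "\<And>a' b' v. a' \<in> Poly_Mapping.keys p \<Longrightarrow> b' \<in> Poly_Mapping.keys q \<Longrightarrow> a' + b' = a + b \<Longrightarrow>
      Poly_Mapping.lookup a' v = Poly_Mapping.lookup a v \<and> Poly_Mapping.lookup b' v = Poly_Mapping.lookup b v"
    using extreme_monomials[of UNIV "Poly_Mapping.keys p" "Poly_Mapping.keys q"] by auto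
  have eq: "a' = a \<and> b' = b" if "a' \<in> Poly_Mapping.keys p" "b' \<in> Poly_Mapping.keys q" "a + b = a' + b'" for a' b'
    using unique[OF that(1,2)] that(3) by (metis poly_mapping_eqI)
  have inner: "Poly_Mapping.lookup p l * (\<Sum>m. Poly_Mapping.lookup q m when a + b = l + m) =
    (Poly_Mapping.lookup p a * Poly_Mapping.lookup q b when l = a)" for l
  proof (cases "l \<in> Poly_Mapping.keys p")
    case True
    have "(\<Sum>m. Poly_Mapping.lookup q m when a + b = l + m) =
      (\<Sum>m. (Poly_Mapping.lookup q b when l = a) when m = b)"
      by (rule Sum_any.cong) (use eq[OF True] in \<open>auto simp: when_def in_keys_iff\<close>)
    then show ?thesis by (auto simp: when_def)
  next
    case False
    then show ?thesis using ab(1) by (auto simp: in_keys_iff when_def)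
  qed
  have "Poly_Mapping.lookup (p * q) (a + b) = Poly_Mapping.lookup p a * Poly_Mapping.lookup q b"
    unfolding lookup_mult inner by simp
  with assms ab show False by (simp add: in_keys_iff)
qed

section \<open>Free modules\<close>

context module
begin

lemma basis_coordinates_eqI:
  assumes "independent B" "span B = UNIV" "representation B x = representation B y"
  shows "x = y"
  using sum_nonzero_representation_eq[OF assms(1)] assms(2,3) by (metis UNIV_I)

lemma free_torsion_free:
  assumes domain: "\<And>a b :: 'a. a * b = 0 \<Longrightarrow> a = 0 \<or> b = 0"
    and B: "independent B" "span B = UNIV" and "scale a x = 0"
  shows "a = 0 \<or> x = 0"
proof -
  have "a * representation B x b = 0" for b
    using representation_scale[OF B(1), of x a] B(2) assms(4) by (metis UNIV_I representation_zero)
  then have "representation B x = representation B 0" if "a \<noteq> 0"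
    using domain that by (auto simp: representation_zero)
  then show ?thesis using basis_coordinates_eqI[OF B] by blast
qed

text \<open>
  An additive map \<open>h\<close> of the ring acts on the coordinates with respect to a basis; the resulting \<open>H\<close>
  inherits from \<open>h\<close> that it divides by \<open>a\<close>, or commutes with \<open>a\<close>.
\<close>

lemma extend_coordinatewise:
  assumes B: "independent B" "span B = UNIV" and h: "additive h"
  obtains H where "additive H"
    "\<And>a x. (\<And>p. h (a * p) = p) \<Longrightarrow> H (scale a x) = x"
    "\<And>a x. (\<And>p. h (a * p) = a * h p) \<Longrightarrow> H (scale a x) = scale a (H x)"
proof -
  let ?r = "representation B"
  have UN: "x \<in> span B" for x using B(2) by simp
  define H where "H x = (\<Sum>b | ?r x b \<noteq> 0. scale (h (?r x b)) b)" for x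
  have rep: "?r (H x) b = h (?r x b)" for x b
  proof -
    have sub: "{b. h (?r x b) \<noteq> 0} \<subseteq> {b. ?r x b \<noteq> 0}"
      using additive.zero[OF h] by auto
    have "(\<Sum>b | h (?r x b) \<noteq> 0. scale (h (?r x b)) b) = H x"
      unfolding H_def by (rule sum.mono_neutral_left) (use sub finite_representation in auto)
    then have "?r (H x) = (\<lambda>b. h (?r x b))"
      using sub by (intro representation_eqI[OF B(1) UN])
        (auto intro: representation_ne_zero finite_subset[OF sub finite_representation])
    then show ?thesis by simp
  qed
  show thesis
  proof
    show "additive H"
    proof
      show "H (x + y) = H x + H y" for x y
        by (rule basis_coordinates_eqI[OF B])
          (auto simp: rep representation_add[OF B(1) UN UN] additive.add[OF h])
    qed
    show "H (scale a x) = x" if "\<And>p. h (a * p) = p" for a x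
      by (rule basis_coordinates_eqI[OF B]) (auto simp: rep representation_scale[OF B(1) UN] that)
    show "H (scale a x) = scale a (H x)" if "\<And>p. h (a * p) = a * h p" for a x
      by (rule basis_coordinates_eqI[OF B]) (auto simp: rep representation_scale[OF B(1) UN] that)
  qed
qed

lemma direct_summand_projection:
  assumes "direct_summand scale P"
  obtains \<pi> where "module_hom scale scale \<pi>" "\<And>x. \<pi> x = 0 \<longleftrightarrow> x \<in> P" "\<And>x. x - \<pi> x \<in> P"
proof -
  obtain N where P: "subspace P" and N: "subspace N" "P \<inter> N = {0}" "P + N = UNIV"
    using assms by (auto simp: direct_summand_def)
  have "\<exists>n. n \<in> N \<and> x - n \<in> P" for x
  proof -
    have "x \<in> P + N" using N(3) by simp
    then show ?thesis by (auto simp: set_plus_def)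
  qed
  then obtain \<pi> where \<pi>: "\<And>x. \<pi> x \<in> N" "\<And>x. x - \<pi> x \<in> P" by metis
  have unique: "\<pi> x = n" if "n \<in> N" "x - n \<in> P" for x n
  proof -
    have "(x - n) - (x - \<pi> x) \<in> P" "\<pi> x - n \<in> N"
      using \<pi> that P N(1) subspace_diff by blast+
    then have "\<pi> x - n \<in> P \<inter> N" by simp
    then show ?thesis using N(2) by simp
  qed
  show thesis
  proof
    show "module_hom scale scale \<pi>"
    proof
      show "\<pi> (x + y) = \<pi> x + \<pi> y" for x y
        using subspace_add[OF P \<pi>(2) \<pi>(2), of x y]
        by (intro unique subspace_add[OF N(1)] \<pi>) (simp add: algebra_simps)
      show "\<pi> (scale a x) = scale a (\<pi> x)" for a x
        using subspace_scale[OF P \<pi>(2), of a x]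
        by (intro unique subspace_scale[OF N(1)] \<pi>) (simp add: scale_right_diff_distrib)
    qed
    show "x - \<pi> x \<in> P" for x by (rule \<pi>)
    show "\<pi> x = 0 \<longleftrightarrow> x \<in> P" for x
      using unique[of 0 x] \<pi>(2)[of x] subspace_0[OF N(1)] by auto
  qed
qed

lemma direct_summand_torsion_free:
  assumes "\<And>a x. scale a x = 0 \<Longrightarrow> a = 0 \<or> x = 0"
    and "direct_summand scale P" "scale a x \<in> P"
  shows "a = 0 \<or> x \<in> P"
proof -
  obtain \<pi> where \<pi>: "module_hom scale scale \<pi>" "\<And>x. \<pi> x = 0 \<longleftrightarrow> x \<in> P"
    using direct_summand_projection[OF assms(2)] by metis
  interpret \<pi>: module_hom scale scale \<pi> by fact
  show ?thesis using assms(1,3) \<pi>(2) \<pi>.scale by metis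
qed

text \<open>
  Gaussian elimination without division: if some \<open>x i\<close> involves the generator \<open>b\<close> with coefficient
  \<open>c i \<noteq> 0\<close>, the vectors \<open>c i x j - c j x i\<close> for \<open>j \<noteq> i\<close> no longer involve \<open>b\<close>, and a relation
  between them is one between the \<open>x j\<close>.
\<close>

lemma more_vectors_than_generators:
  assumes domain: "\<And>a b :: 'a. a * b = 0 \<Longrightarrow> a = 0 \<or> b = 0"
    and "finite B" "finite J" "card B < card J" "\<And>j. j \<in> J \<Longrightarrow> x j \<in> span B"
  shows "\<exists>a. (\<exists>j\<in>J. a j \<noteq> 0) \<and> (\<Sum>j\<in>J. scale (a j) (x j)) = 0"
  using assms(2-)
proof (induction arbitrary: J x rule: finite_induct)
  case empty
  then obtain j where "j \<in> J" by (metis card.empty equals0I less_irrefl)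
  moreover have "x j = 0" if "j \<in> J" for j using empty that by simp
  ultimately show ?case by (intro exI[of _ "\<lambda>_. 1"]) auto
next
  case (insert b B)
  have "\<exists>c. x j - scale c b \<in> span B" if "j \<in> J" for j
    using insert.prems(3)[OF that] by (simp add: span_breakdown_eq)
  then obtain c where c: "\<And>j. j \<in> J \<Longrightarrow> x j - scale (c j) b \<in> span B" by metis
  show ?case
  proof (cases "\<exists>i\<in>J. c i \<noteq> 0")
    case False
    then have "x j \<in> span B" if "j \<in> J" for j using c[OF that] that by simp
    then show ?thesis using insert.IH[of J x] insert.prems insert.hyps by simp
  next
    case True
    then obtain i where i: "i \<in> J" "c i \<noteq> 0" by blast
    let ?y = "\<lambda>j. scale (c i) (x j) - scale (c j) (x i)"
    have "?y j \<in> span B" if "j \<in> J" for j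
    proof -
      have "scale (c i) (x j - scale (c j) b) - scale (c j) (x i - scale (c i) b) \<in> span B"
        by (rule span_diff[OF span_scale[OF c[OF that]] span_scale[OF c[OF i(1)]]])
      then show ?thesis by (simp add: scale_right_diff_distrib mult.commute)
    qed
    moreover have "card B < card (J - {i})" using insert i by simp
    ultimately obtain a j where a: "j \<in> J - {i}" "a j \<noteq> 0" "(\<Sum>j\<in>J - {i}. scale (a j) (?y j)) = 0"
      using insert.IH[of "J - {i}" ?y] insert.prems(1) by auto
    define a' where "a' j = (if j = i then - (\<Sum>k\<in>J - {i}. a k * c k) else a j * c i)" for j
    have "(\<Sum>j\<in>J. scale (a' j) (x j)) = scale (a' i) (x i) + (\<Sum>j\<in>J - {i}. scale (a j * c i) (x j))"
      using i insert.prems(1) by (subst sum.remove[of J i]) (auto simp: a'_def intro: sum.cong)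
    also have "\<dots> = (\<Sum>j\<in>J - {i}. scale (a j) (?y j))"
      by (simp add: a'_def scale_sum_left scale_right_diff_distrib sum_subtractf)
    finally have "(\<Sum>j\<in>J. scale (a' j) (x j)) = 0" using a(3) by simp
    moreover have "a' j \<noteq> 0" using a(1,2) i(2) domain by (auto simp: a'_def)
    ultimately show ?thesis using a(1) by blast
  qed
qed

end

text \<open>
  Project \<open>C\<close> to a complement of \<open>P\<close>, which represents \<open>C / P\<close>, and divide all coordinates there by
  \<open>mvar v ^ N\<close>. The division commutes with multiplication by the other variables.
\<close>

lemma mvar_powers_division_regular:
  fixes scale :: "('v, 'k::comm_ring_1) mpoly \<Rightarrow> 'c::ab_group_add \<Rightarrow> 'c"
  assumes "module scale" "free_submodule scale UNIV" "direct_summand scale P" "distinct vs"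
  shows "division_regular scale P (map (\<lambda>v. mvar v ^ N) vs)"
  using assms(4)
proof (induction vs)
  case (Cons v vs)
  interpret module scale by fact
  obtain B where B: "independent B" "span B = UNIV"
    using assms(2) by (auto simp: free_submodule_def basis_of_def)
  obtain \<pi> where \<pi>: "module_hom scale scale \<pi>" "\<And>x. \<pi> x = 0 \<longleftrightarrow> x \<in> P" "\<And>x. x - \<pi> x \<in> P"
    using direct_summand_projection[OF assms(3)] by blast
  interpret \<pi>: module_hom scale scale \<pi> by fact
  have P: "subspace P" using assms(3) by (simp add: direct_summand_def)
  have "additive (divide_mvar v N :: ('v, 'k) mpoly \<Rightarrow> _)"
    by (simp add: additive_def divide_mvar_add)
  from extend_coordinatewise[OF B this] obtain H where H: "additive H"
    "\<And>a x. (\<And>p. divide_mvar v N (a * p) = p) \<Longrightarrow> H (scale a x) = x"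
    "\<And>a x. (\<And>p. divide_mvar v N (a * p) = a * divide_mvar v N p) \<Longrightarrow> H (scale a x) = scale a (H x)"
    by blast
  have "additive (\<lambda>x. H (\<pi> x))"
    by (simp add: additive_def additive.add[OF H(1)] \<pi>.add)
  moreover have "(\<lambda>x. H (\<pi> x)) ` P \<subseteq> P"
  proof (rule image_subsetI)
    fix x assume "x \<in> P"
    then have "\<pi> x = 0" by (rule \<pi>(2)[THEN iffD2])
    then show "H (\<pi> x) \<in> P" by (simp only: additive.zero[OF H(1)] subspace_0[OF P])
  qed
  moreover have "H (\<pi> (scale (mvar v ^ N) x)) - x \<in> P" for x
    using subspace_neg[OF P \<pi>(3), of x] by (simp add: \<pi>.scale H(2) divide_mvar_self)
  moreover have "H (\<pi> (scale b x)) = scale b (H (\<pi> x))" if b: "b \<in> set (map (\<lambda>v. mvar v ^ N) vs)" for b x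
  proof -
    obtain u where "b = mvar u ^ N" "u \<noteq> v" using b Cons.prems by auto
    then show ?thesis by (simp add: \<pi>.scale H(3) divide_mvar_other)
  qed
  ultimately have "\<exists>Q. additive Q \<and> Q ` P \<subseteq> P \<and> (\<forall>x. Q (scale (mvar v ^ N) x) - x \<in> P) \<and>
    (\<forall>b\<in>set (map (\<lambda>v. mvar v ^ N) vs). \<forall>x. Q (scale b x) = scale b (Q x))"
    by (intro exI[of _ "\<lambda>x. H (\<pi> x)"] conjI allI ballI)
  moreover have "division_regular scale P (map (\<lambda>v. mvar v ^ N) vs)" using Cons by simp
  ultimately show ?case unfolding list.map division_regular.simps by (intro conjI)
qed simp

section \<open>Independent elements from minimality\<close>

context differential_module
begin

text \<open>
  Modulo \<open>F (k - 2)\<close>, a relation whose last nonzero coefficient is \<open>a k\<close> reduces to \<open>a k * d (y k) = 0\<close>,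
  against torsion-freeness.
\<close>

lemma differentials_independent:
  fixes l :: nat
  assumes F: "\<And>i. i \<le> l \<Longrightarrow> m1.subspace (F i)" "\<And>i j. i \<le> j \<Longrightarrow> j \<le> l \<Longrightarrow> F i \<subseteq> F j"
    and torsion_free: "\<And>i a x. i \<le> l \<Longrightarrow> scale a x \<in> F i \<Longrightarrow> a = 0 \<or> x \<in> F i"
    and y: "\<And>i. i \<in> {2..l} \<Longrightarrow> d (y i) \<in> F (i - 1)" "\<And>i. i \<in> {2..l} \<Longrightarrow> d (y i) \<notin> F (i - 2)"
    and sum: "(\<Sum>i\<in>{2..l}. scale (a i) (d (y i))) = 0" and "i \<in> {2..l}"
  shows "a i = 0"
proof (rule ccontr)
  assume "a i \<noteq> 0"
  define k where "k = Max {i \<in> {2..l}. a i \<noteq> 0}"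
  have fin: "finite {i \<in> {2..l}. a i \<noteq> 0}" by simp
  have "k \<in> {i \<in> {2..l}. a i \<noteq> 0}"
    unfolding k_def by (rule Max_in) (use \<open>i \<in> {2..l}\<close> \<open>a i \<noteq> 0\<close> in auto)
  then have k: "k \<in> {2..l}" "a k \<noteq> 0" by auto
  have above: "a j = 0" if "j \<in> {2..l}" "k < j" for j
  proof (rule ccontr)
    assume "a j \<noteq> 0"
    then have "j \<le> k" unfolding k_def using that(1) by (intro Max_ge[OF fin]) simp
    then show False using that(2) by simp
  qed
  have sub: "m1.subspace (F (k - 2))" by (rule F(1)) (use k(1) in auto)
  have "scale (a j) (d (y j)) \<in> F (k - 2)" if j: "j \<in> {2..l} - {k}" for j
  proof (cases "j < k")
    case True
    have "F (j - 1) \<subseteq> F (k - 2)" by (rule F(2)) (use True k(1) in auto)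
    then show ?thesis using y(1)[of j] j m1.subspace_scale[OF sub] by auto
  next
    case False
    then show ?thesis using above[of j] j m1.subspace_0[OF sub] by auto
  qed
  then have "(\<Sum>j\<in>{2..l} - {k}. scale (a j) (d (y j))) \<in> F (k - 2)"
    by (rule m1.subspace_sum[OF sub])
  moreover have "scale (a k) (d (y k)) = - (\<Sum>j\<in>{2..l} - {k}. scale (a j) (d (y j)))"
    using sum k(1) by (simp add: sum.remove add_eq_0_iff2)
  ultimately have "scale (a k) (d (y k)) \<in> F (k - 2)"
    using m1.subspace_neg[OF sub] by simp
  moreover have "k - 2 \<le> l" using k(1) by auto
  ultimately show False using torsion_free[of "k - 2" "a k" "d (y k)"] k(2) y(2)[OF k(1)] by blast
qed

text \<open>
  The \<open>y i\<close> together with the \<open>d (y i)\<close> are independent: applying \<open>d\<close> to a relation, \<open>d \<circ> d = 0\<close> leaves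
  the coefficients of the \<open>y i\<close> in a relation between the \<open>d (y i)\<close>.
\<close>

theorem generators_of_minimal_filtration:
  fixes l :: nat
  assumes domain: "\<And>a b :: 'a. a * b = 0 \<Longrightarrow> a = 0 \<or> b = 0"
    and F: "\<And>i. i \<le> l \<Longrightarrow> m1.subspace (F i)" "\<And>i j. i \<le> j \<Longrightarrow> j \<le> l \<Longrightarrow> F i \<subseteq> F j"
    and torsion_free: "\<And>i a x. i \<le> l \<Longrightarrow> scale a x \<in> F i \<Longrightarrow> a = 0 \<or> x \<in> F i"
    and y: "\<And>i. i \<in> {2..l} \<Longrightarrow> d (y i) \<in> F (i - 1)" "\<And>i. i \<in> {2..l} \<Longrightarrow> d (y i) \<notin> F (i - 2)"
    and B: "finite B" "m1.span B = UNIV"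
  shows "2 * (l - 1) \<le> card B"
proof (rule ccontr)
  assume few: "\<not> ?thesis"
  define x where "x = (\<lambda>(i, b). if b then d (y i) else y i)"
  let ?J = "{2..l} \<times> (UNIV :: bool set)"
  have "card B < card ?J" using few by (simp add: card_cartesian_product)
  then obtain a where a: "\<exists>j\<in>?J. a j \<noteq> 0" "(\<Sum>j\<in>?J. scale (a j) (x j)) = 0"
    using m1.more_vectors_than_generators[OF domain B(1), of ?J x] B(2) by auto
  have rel: "(\<Sum>i\<in>{2..l}. scale (a (i, False)) (y i) + scale (a (i, True)) (d (y i))) = 0"
  proof -
    have "(\<Sum>i\<in>{2..l}. \<Sum>b\<in>UNIV. scale (a (i, b)) (x (i, b))) = 0"
      using a(2) by (simp add: sum.cartesian_product)
    then show ?thesis by (simp add: UNIV_bool x_def)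
  qed
  have "(\<Sum>i\<in>{2..l}. scale (a (i, False)) (d (y i))) =
    d (\<Sum>i\<in>{2..l}. scale (a (i, False)) (y i) + scale (a (i, True)) (d (y i)))"
    by (simp add: sum add scale d_squared)
  then have False0: "a (i, False) = 0" if "i \<in> {2..l}" for i
    using differentials_independent[OF F torsion_free y, where a = "\<lambda>i. a (i, False)"] that rel by simp
  with rel have "(\<Sum>i\<in>{2..l}. scale (a (i, True)) (d (y i))) = 0" by simp
  then have "a (i, True) = 0" if "i \<in> {2..l}" for i
    using differentials_independent[OF F torsion_free y, where a = "\<lambda>i. a (i, True)"] that by simp
  with False0 a(1) show False by (metis (full_types) mem_Sigma_iff surj_pair)
qed

lemma homology_annihilatorD:
  assumes "a \<in> homology_annihilator scale d" "d z = 0"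
  shows "\<exists>w. scale a z = d w"
proof -
  have range: "m1.subspace (range d)" using subspace_image[OF m1.subspace_UNIV] by simp
  have hom: "module_hom scale scale (scale a)" by simp
  have "z +o range d \<in> homology d"
    using assms(2) by (auto simp: homology_def quotient_module_def)
  then have "quotient_map (scale a) (range d) (z +o range d) = range d"
    using assms(1) by (simp add: homology_annihilator_def)
  moreover have "quotient_map (scale a) (range d) (z +o range d) = scale a z +o range d"
    by (rule quotient_map_coset[OF hom range range]) (use m1.subspace_scale[OF range] in blast)
  moreover have "scale a z \<in> scale a z +o range d"
    using m1.subspace_0[OF range] by (auto simp: elt_set_plus_def)
  ultimately have "scale a z \<in> range d" by metis
  then show ?thesis by blast
qed

end

theorem corollary4p6:
  fixes scale :: "('v::finite, 'k::field) mpoly \<Rightarrow> 'c::ab_group_add \<Rightarrow> 'c"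
    and d :: "'c \<Rightarrow> 'c"
    and e :: "nat \<Rightarrow> 'v"
    and F :: "nat \<Rightarrow> 'c set"
    and \<epsilon> :: "'c \<Rightarrow> 'k"
    and r l m s :: nat
  assumes variables: "bij_betw e {1..r} UNIV"
    and diff_module: "differential_module scale d"
    and free: "free_submodule scale UNIV"
    and F_bottom: "F 0 = {0}"
    and F_top: "F l = UNIV"
    and F_proper: "\<forall>i\<in>{1..l}. F (i - 1) \<subset> F i"
    and F_free: "\<forall>i\<in>{0..l}. differential_submodule scale d (F i) \<and>
                   free_submodule scale (F i) \<and> direct_summand scale (F i)"
    and F_d: "\<forall>i\<in>{1..l}. d ` F i \<subseteq> F (i - 1)"
    and F_minimal: "\<forall>i\<in>{2..l}. \<exists>X\<in>quotient_module (F i) (F (i - 1)).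
                      quotient_map d (F (i - 2)) X \<noteq> F (i - 2)"
    and eps_hom: "module_hom scale residue_scale \<epsilon>"
    and eps_d: "\<forall>x. \<epsilon> (d x) = 0"
    and eps_surj: "\<epsilon> ` F 1 = UNIV"
    and s_range: "1 \<le> s" "s \<le> r"
    and annihilated: "\<forall>i\<in>{1..s}. mvar (e i) ^ (m + 1) \<in> homology_annihilator scale d"
  shows "free_rank scale UNIV \<ge> enat (2 * s) \<and> l \<ge> s + 1"
proof -
  interpret differential_module scale d by fact
  interpret \<epsilon>: module_hom scale residue_scale \<epsilon> by fact
  have mono: "F i \<subseteq> F j" if "i \<le> j" "j \<le> l" for i j
    using that
  proof (induction rule: dec_induct)
    case (step j)
    then show ?case using F_proper[rule_format, of "Suc j"] by auto
  qed simp
  have sub: "m1.subspace (F i)" and summand: "direct_summand scale (F i)" if "i \<le> l" for i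
    using F_free that by (auto simp: differential_submodule_def)
  have d_step: "d x \<in> F (i - 1)" if "x \<in> F i" "i \<in> {1..l}" for i x
    using bspec[OF F_d that(2)] that(1) by blast

  have "s < l"
  proof (rule ccontr)
    assume "\<not> s < l"
    obtain x where x: "x \<in> F 1" "\<epsilon> x = 1" using eps_surj by (metis UNIV_I imageE)
    have "l \<noteq> 0"
    proof
      assume "l = 0"
      then have "x = 0" using F_top F_bottom by auto
      then show False using x(2) by simp
    qed
    then have "d x = 0" using d_step[OF x(1)] F_bottom by auto
    \<comment> \<open>Since \<open>l \<le> s\<close>, repeating the last step \<open>F l = UNIV\<close> gives a filtration with exactly \<open>s\<close> steps.\<close>
    define gs where "gs = map (\<lambda>i. mvar (e i) ^ (m + 1) :: ('v, 'k) mpoly) [1..<s + 1]"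
    have len: "length gs = s" by (simp add: gs_def)
    have "inj_on e {1..<s + 1}"
      using bij_betw_imp_inj_on[OF variables] by (rule inj_on_subset) (use s_range in auto)
    then have distinct: "distinct (map e [1..<s + 1])" by (simp only: distinct_map distinct_upt set_upt)
    have powers: "map (\<lambda>g. g ^ N) gs = map (\<lambda>v. mvar v ^ ((m + 1) * N)) (map e [1..<s + 1])" for N
      unfolding gs_def by (simp only: list.map_comp o_def power_mult)
    have "x \<in> range d"
    proof (rule acyclic_if_filtration_short[where G = "\<lambda>i. F (min i l)" and gs = gs])
      show "m1.subspace (F (min i l))" for i by (rule sub) simp
      show "F (min 0 l) = {0}" "F (min (length gs) l) = UNIV"
        using F_bottom F_top \<open>\<not> s < l\<close> by (simp_all add: len min_def)
      show "d ` F (min (Suc i) l) \<subseteq> F (min i l)" for i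
      proof (cases "Suc i \<le> l")
        case True
        then show ?thesis using d_step[of _ "Suc i"] by (auto simp: min_def)
      next
        case False
        then have "min i l = l" by simp
        then show ?thesis using F_top by simp
      qed
      show "division_regular scale (F (min i l)) (map (\<lambda>g. g ^ N) gs)" for i N
        unfolding powers
        by (rule mvar_powers_division_regular[OF m1.module_axioms free summand distinct]) simp
      show "\<exists>w. scale g z = d w" if "g \<in> set gs" "d z = 0" for g z
        using that annihilated by (intro homology_annihilatorD) (auto simp: gs_def)
    qed fact
    then show False using eps_d x(2) by auto
  qed

  obtain B where B: "basis_of scale UNIV B" using free by (auto simp: free_submodule_def)
  have torsion_free: "a = 0 \<or> x = 0" if "scale a x = 0" for a x
    using m1.free_torsion_free[OF mpoly_no_zero_divisors _ _ that] B by (auto simp: basis_of_def)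
  have "\<exists>y \<in> F i. d y \<notin> F (i - 2)" if i: "i \<in> {2..l}" for i
  proof -
    obtain y where y: "y \<in> F i" "quotient_map d (F (i - 2)) (y +o F (i - 1)) \<noteq> F (i - 2)"
      using bspec[OF F_minimal i] unfolding quotient_module_def by blast
    have sub': "m1.subspace (F (i - 1))" "m1.subspace (F (i - 2))" by (rule sub, use i in auto)+
    have "i - 1 \<in> {1..l}" using i by auto
    from bspec[OF F_d this] have "d ` F (i - 1) \<subseteq> F (i - 2)" by (simp add: numeral_2_eq_2)
    then have "d y +o F (i - 2) \<noteq> F (i - 2)"
      using y(2) quotient_map_coset[OF module_hom_d sub'] by simp
    moreover have "d y +o F (i - 2) = F (i - 2)" if "d y \<in> F (i - 2)"
    proof (intro equalityI subsetI)
      fix x assume "x \<in> F (i - 2)"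
      then have "x - d y \<in> F (i - 2)" using that m1.subspace_diff[OF sub'(2)] by blast
      then show "x \<in> d y +o F (i - 2)"
        unfolding elt_set_plus_def by (intro CollectI bexI[of _ "x - d y"]) simp_all
    qed (use that m1.subspace_add[OF sub'(2)] in \<open>auto simp: elt_set_plus_def\<close>)
    ultimately show ?thesis using y(1) by blast
  qed
  then obtain y where y: "\<And>i. i \<in> {2..l} \<Longrightarrow> y i \<in> F i" "\<And>i. i \<in> {2..l} \<Longrightarrow> d (y i) \<notin> F (i - 2)"
    by metis
  have rank: "2 * s \<le> card B" if "basis_of scale UNIV B" "finite B" for B
  proof -
    have "2 * (l - 1) \<le> card B"
    proof (rule generators_of_minimal_filtration[where F = F and y = y])
      show "a = 0 \<or> x \<in> F i" if "i \<le> l" "scale a x \<in> F i" for i a x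
        using m1.direct_summand_torsion_free[OF torsion_free summand] that by blast
      show "d (y i) \<in> F (i - 1)" if "i \<in> {2..l}" for i
        using d_step[OF y(1)] that by auto
    qed (use mpoly_no_zero_divisors sub mono y that in \<open>auto simp: basis_of_def\<close>)
    then show ?thesis using \<open>s < l\<close> by simp
  qed
  have "basis_of scale UNIV (SOME B. basis_of scale UNIV B)" using B by (rule someI)
  then have "enat (2 * s) \<le> free_rank scale UNIV"
    using rank by (auto simp: free_rank_def Let_def)
  then show ?thesis using \<open>s < l\<close> by simp
qed

end
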